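(* Let $\mathcal{A}=(\Sigma,Q,\delta,\gamma)$ be a UCA schema and let $\mathcal{C}=(\Sigma\times Q, Q', q_0', \delta',\gamma')$ be its collection automaton. Then $\mathcal{C}$ (read as a universal co-Büchi automaton) accepts a word $\varpi=(\sigma_0,q_0)(\sigma_1,q_1)(\sigma_2,q_2)\ldots\in(\Sigma\times Q)^\omega$ if and only if it satisfies all promises, i.e. for every $i\ge 0$, $\sigma_i\sigma_{i+1}\sigma_{i+2}\ldots\in\mathcal{L}(\mathcal{A},q_i)$.
   Context: A UCA schema $\mathcal{A}=(\Sigma,Q,\delta,\gamma)$ has a finite alphabet $\Sigma$, finite state set $Q$, transition function $\delta:Q\times\Sigma\to 2^Q$ and rejecting transitions $\gamma:Q\times\Sigma\to 2^Q$ with $\gamma(q,\sigma)\subseteq\delta(q,\sigma)$; a transition $(q,\sigma,q')$ is rejecting if $q'\in\gamma(q,\sigma)$. A run from $q$ on $w=w_0w_1\ldots$ is a sequence $\rho_0 w_0\rho_1 w_1\ldots$ with $\rho_0=q$ and $\rho_{i}\in\delta(\rho_{i-1},w_{i-1})$; it is rejecting if some rejecting transition occurs infinitely often. $\mathcal{L}(\mathcal{A},q)$ is the set of words having no rejecting run from $q$. The collection automaton is defined with a fresh state $q_0'\notin Q$, $Q'=Q\cup\{q_0'\}$, alphabet $\Sigma\times Q$, initial state $q_0'$, and for all $q,q'\in Q$, $\sigma\in\Sigma$: $\delta'(q,(\sigma,q'))=\delta(q,\sigma)$, $\gamma'(q,(\sigma,q'))=\gamma(q,\sigma)$, $\delta'(q_0',(\sigma,q))=\{q_0'\}\cup\delta(q,\sigma)$,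 and $\gamma'(q_0',(\sigma,q))=\delta(q,\sigma)$ (so the self-loop on $q_0'$ is non-rejecting and all transitions from $q_0'$ into $Q$ are rejecting). $\mathcal{C}$ accepts a word iff it has no rejecting run from $q_0'$. *)

theory Defs
  imports "HOL-Library.Omega_Words_Fun"
begin

record ('a, 'q) uca_schema =
  alphabet :: "'a set"
  states :: "'q set"
  trans :: "'q \<Rightarrow> 'a \<Rightarrow> 'q set"
  rej :: "'q \<Rightarrow> 'a \<Rightarrow> 'q set"

record ('a, 'q) uca = "('a, 'q) uca_schema" +
  initial :: 'q

text \<open>The transition functions are only constrained on \<open>states \<times> alphabet\<close>; their values
  elsewhere are irrelevant.\<close>

definition wf_schema :: "('a, 'q, 'm) uca_schema_scheme \<Rightarrow> bool" where
  "wf_schema A \<longleftrightarrow> finite (alphabet A) \<and> finite (states A) \<and>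
     (\<forall>q \<in> states A. \<forall>\<sigma> \<in> alphabet A.
        trans A q \<sigma> \<subseteq> states A \<and> rej A q \<sigma> \<subseteq> trans A q \<sigma>)"

definition wf_uca :: "('a, 'q, 'm) uca_scheme \<Rightarrow> bool" where
  "wf_uca A \<longleftrightarrow> wf_schema A \<and> initial A \<in> states A"

text \<open>A run \<open>\<rho>\<^sub>0 w\<^sub>0 \<rho>\<^sub>1 w\<^sub>1 \<dots>\<close> is represented by its state sequence \<open>\<rho>\<close> together with the word \<open>w\<close>.\<close>

definition is_run :: "('a, 'q, 'm) uca_schema_scheme \<Rightarrow> 'q \<Rightarrow> 'a word \<Rightarrow> 'q word \<Rightarrow> bool" where
  "is_run A q w \<rho> \<longleftrightarrow> \<rho> 0 = q \<and> (\<forall>i. \<rho> (Suc i) \<in> trans A (\<rho> i) (w i))"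

text \<open>One single rejecting transition has to be repeated infinitely often.\<close>

definition rejecting :: "('a, 'q, 'm) uca_schema_scheme \<Rightarrow> 'a word \<Rightarrow> 'q word \<Rightarrow> bool" where
  "rejecting A w \<rho> \<longleftrightarrow>
     (\<exists>p \<sigma> p'. p' \<in> rej A p \<sigma> \<and> (\<exists>\<^sub>\<infinity>i. \<rho> i = p \<and> w i = \<sigma> \<and> \<rho> (Suc i) = p'))"

definition lang :: "('a, 'q, 'm) uca_schema_scheme \<Rightarrow> 'q \<Rightarrow> 'a word set" where
  "lang A q = {w. range w \<subseteq> alphabet A \<and> \<not> (\<exists>\<rho>. is_run A q w \<rho> \<and> rejecting A w \<rho>)}"

definition accepts :: "('a, 'q, 'm) uca_scheme \<Rightarrow> 'a word \<Rightarrow> bool" where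
  "accepts A w \<longleftrightarrow> w \<in> lang A (initial A)"

text \<open>The fresh state is \<open>None\<close>; a state \<open>q\<close> of the schema is embedded as \<open>Some q\<close>.\<close>

fun coll_trans :: "('a, 'q, 'm) uca_schema_scheme \<Rightarrow> 'q option \<Rightarrow> 'a \<times> 'q \<Rightarrow> 'q option set" where
  "coll_trans A (Some q) (\<sigma>, q') = Some ` trans A q \<sigma>"
| "coll_trans A None (\<sigma>, q) = {None} \<union> Some ` trans A q \<sigma>"

fun coll_rej :: "('a, 'q, 'm) uca_schema_scheme \<Rightarrow> 'q option \<Rightarrow> 'a \<times> 'q \<Rightarrow> 'q option set" where
  "coll_rej A (Some q) (\<sigma>, q') = Some ` rej A q \<sigma>"
| "coll_rej A None (\<sigma>, q) = Some ` trans A q \<sigma>"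

definition collection ::
  "('a, 'q, 'm) uca_schema_scheme \<Rightarrow> ('a \<times> 'q, 'q option) uca" where
  "collection A =
     \<lparr> alphabet = alphabet A \<times> states A,
       states = Some ` states A \<union> {None},
       trans = coll_trans A,
       rej = coll_rej A,
       initial = None \<rparr>"

lemma wf_uca_collection: "wf_schema A \<Longrightarrow> wf_uca (collection A)"
  by (fastforce simp: wf_schema_def wf_uca_def collection_def)

end

theory Submission
  imports Defs
begin

text \<open>A run of the collection automaton stays in the fresh state until it leaves it at some position
  \<open>i\<close>, from where it behaves like a run of \<open>A\<close> from \<open>q\<^sub>i\<close> on the suffix at \<open>i\<close>; conversely every such
  run arises in this way. Each transition out of the fresh state is taken at most once, so the two
  runs agree on which rejecting transitions of \<open>A\<close> recur. The letters of the collection automaton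
  carry an additional state, so a recurring transition of \<open>A\<close> need not determine a single transition
  there; one recurs by the pigeonhole principle, as there are finitely many states.\<close>

text \<open>Allows finite prefixes to be discarded when recurrence is compared between two runs that
  are offset from each other.\<close>

lemma INFM_shift_iff: "(\<exists>\<^sub>\<infinity>i. P (i + k)) \<longleftrightarrow> (\<exists>\<^sub>\<infinity>i. P i)" for P :: "nat \<Rightarrow> bool"
  using eventually_sequentially_seg[of "\<lambda>i. \<not> P i" k]
  by (simp add: frequently_def cofinite_eq_sequentially)

lemma collection_simps [simp]:
  "alphabet (collection A) = alphabet A \<times> states A"
  "trans (collection A) = coll_trans A"
  "rej (collection A) = coll_rej A"
  "initial (collection A) = None"
  by (simp_all add: collection_def)

lemma coll_trans_Some:
  "coll_trans A (Some q) x = Some ` trans A q (fst x)"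
  by (cases x) simp

lemma coll_trans_None:
  "coll_trans A None x = insert None (Some ` trans A (snd x) (fst x))"
  by (cases x) simp

text \<open>Position \<open>i\<close> still carries \<open>None\<close>, so \<open>\<rho> 0\<close>
  never appears: the promise in the letter \<open>w i\<close> stands in for it.\<close>

definition collection_run :: "nat \<Rightarrow> 'q word \<Rightarrow> 'q option word" where
  "collection_run i \<rho> j = (if j \<le> i then None else Some (\<rho> (j - i)))"

lemma is_run_collection_run:
  assumes "is_run A (snd (w i)) (fst \<circ> suffix i w) \<rho>"
  shows "is_run (collection A) None w (collection_run i \<rho>)"
  unfolding is_run_def
proof (intro conjI allI)
  fix j
  have step: "\<rho> (Suc k) \<in> trans A (\<rho> k) (fst (w (i + k)))" and start: "\<rho> 0 = snd (w i)" for k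
    using assms by (auto simp: is_run_def)
  consider "j < i" | "j = i" | k where "j = i + Suc k"
    by (metis less_iff_Suc_add linorder_neqE_nat add_Suc_right)
  then show "collection_run i \<rho> (Suc j) \<in> trans (collection A) (collection_run i \<rho> j) (w j)"
  proof cases
    \<comment> \<open>The fresh state is left here: the letter \<open>w i\<close> offers the
      successors of its promised state, which is \<open>\<rho> 0\<close>.\<close>
    case 2
    then show ?thesis using step[of 0] start
      by (simp add: collection_run_def coll_trans_None Suc_diff_le)
  next
    case 3
    then show ?thesis using step[of "Suc k"]
      by (simp add: collection_run_def coll_trans_Some Suc_diff_le)
  qed (simp add: collection_run_def coll_trans_None)
qed (simp add: collection_run_def)

text \<open>No transition leads from \<open>Some\<close> back to \<open>None\<close>, so the first
  position outside \<open>None\<close> fixes the shape of the run.\<close>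

lemma collection_run_cases:
  assumes "is_run (collection A) None w \<rho>'"
  obtains "\<And>j. \<rho>' j = None"
  | i \<rho> where "\<rho>' = collection_run i \<rho>" "is_run A (snd (w i)) (fst \<circ> suffix i w) \<rho>"
proof (cases "\<forall>j. \<rho>' j = None")
  case True
  then show ?thesis using that(1) by blast
next
  case False
  have start: "\<rho>' 0 = None" and step: "\<rho>' (Suc j) \<in> coll_trans A (\<rho>' j) (w j)" for j
    using assms by (auto simp: is_run_def)
  define n where "n = (LEAST j. \<rho>' j \<noteq> None)"
  have before: "\<rho>' j = None" if "j < n" for j
    using not_less_Least[of j "\<lambda>j. \<rho>' j \<noteq> None"] that unfolding n_def by auto
  have n: "\<rho>' n \<noteq> None"
    using False LeastI_ex[of "\<lambda>j. \<rho>' j \<noteq> None"] unfolding n_def by auto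
  \<comment> \<open>The run starts in \<open>None\<close>, so \<open>n\<close> is positive and
    \<open>i\<close> is its last position in the fresh state.\<close>
  then obtain i where i: "n = Suc i"
    using start by (cases n) auto
  have after: "\<exists>q. \<rho>' (Suc i + k) = Some q" for k
  proof (induction k)
    case (Suc k)
    then show ?case using step[of "Suc i + k"] by (auto simp: coll_trans_Some)
  qed (use n i in auto)
  \<comment> \<open>As \<open>\<rho>' i\<close> is \<open>None\<close>, the initial state has to be
    taken from the promise.\<close>
  define \<rho> where "\<rho> k = (if k = 0 then snd (w i) else the (\<rho>' (i + k)))" for k
  have some: "\<rho>' (i + Suc k) = Some (\<rho> (Suc k))" for k
    using after[of k] by (auto simp: \<rho>_def)
  show ?thesis
  proof (rule that(2))
    show "\<rho>' = collection_run i \<rho>"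
    proof
      fix j
      show "\<rho>' j = collection_run i \<rho> j"
      proof (cases "j \<le> i")
        case True
        then show ?thesis using before i by (simp add: collection_run_def)
      next
        case False
        then obtain k where "j = i + Suc k"
          by (metis less_iff_Suc_add not_le add_Suc_right)
        then show ?thesis using some[of k] by (simp add: collection_run_def)
      qed
    qed
    show "is_run A (snd (w i)) (fst \<circ> suffix i w) \<rho>"
      unfolding is_run_def
    proof (intro conjI allI)
      fix k
      show "\<rho> (Suc k) \<in> trans A (\<rho> k) ((fst \<circ> suffix i w) k)"
      proof (cases k)
        case 0
        then show ?thesis using step[of i] some[of 0] before[of i] i
          by (auto simp: coll_trans_None \<rho>_def)
      next
        case (Suc l)
        then show ?thesis using step[of "i + Suc l"] some[of l] some[of "Suc l"]
          by (auto simp: coll_trans_Some)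
      qed
    qed (simp add: \<rho>_def)
  qed
qed

lemma rejecting_collection_run_iff:
  assumes "finite (states A)" and "\<And>j. snd (w j) \<in> states A"
  shows "rejecting (collection A) w (collection_run i \<rho>) \<longleftrightarrow> rejecting A (fst \<circ> suffix i w) \<rho>"
proof
  assume "rejecting (collection A) w (collection_run i \<rho>)"
  then obtain p \<sigma> q p' where rej: "p' \<in> coll_rej A p (\<sigma>, q)"
    and inf: "\<exists>\<^sub>\<infinity>j. collection_run i \<rho> j = p \<and> w j = (\<sigma>, q) \<and> collection_run i \<rho> (Suc j) = p'"
    by (auto simp: rejecting_def)
  \<comment> \<open>A recurring transition is also taken after position \<open>i\<close>, hence it
    is not one of the rejecting exits from \<open>None\<close>.\<close>
  obtain j where "j > i" "collection_run i \<rho> j = p" "collection_run i \<rho> (Suc j) = p'"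
    using inf unfolding INFM_nat by blast
  then obtain r r' where r: "p = Some r" "p' = Some r'"
    by (auto simp: collection_run_def)
  have "\<exists>\<^sub>\<infinity>j. collection_run i \<rho> (j + Suc i) = p \<and> w (j + Suc i) = (\<sigma>, q)
      \<and> collection_run i \<rho> (Suc (j + Suc i)) = p'"
    using inf by (subst INFM_shift_iff)
  then have "\<exists>\<^sub>\<infinity>j. \<rho> (j + 1) = r \<and> fst (w (i + (j + 1))) = \<sigma> \<and> \<rho> (Suc (j + 1)) = r'"
    by (rule frequently_elim1) (auto simp: collection_run_def r Suc_diff_le add.commute)
  then have "\<exists>\<^sub>\<infinity>j. \<rho> j = r \<and> fst (w (i + j)) = \<sigma> \<and> \<rho> (Suc j) = r'"
    by (subst (asm) INFM_shift_iff)
  then show "rejecting A (fst \<circ> suffix i w) \<rho>"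
    using rej r by (auto simp: rejecting_def)
next
  assume "rejecting A (fst \<circ> suffix i w) \<rho>"
  then obtain p \<sigma> p' where rej: "p' \<in> rej A p \<sigma>"
    and inf: "\<exists>\<^sub>\<infinity>j. \<rho> j = p \<and> fst (w (i + j)) = \<sigma> \<and> \<rho> (Suc j) = p'"
    by (auto simp: rejecting_def)
  \<comment> \<open>Index 0 of \<open>\<rho>\<close> is skipped because it has no counterpart in the
    collection run.\<close>
  have "\<exists>\<^sub>\<infinity>j. \<rho> (j + 1) = p \<and> fst (w (i + (j + 1))) = \<sigma> \<and> \<rho> (Suc (j + 1)) = p'"
    using inf by (subst INFM_shift_iff)
  then have "\<exists>\<^sub>\<infinity>j. \<exists>q\<in>states A. collection_run i \<rho> (j + Suc i) = Some p \<and> w (j + Suc i) = (\<sigma>, q)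
      \<and> collection_run i \<rho> (Suc (j + Suc i)) = Some p'"
    by (rule frequently_elim1)
      (use assms(2) in \<open>auto simp: collection_run_def Suc_diff_le add.commute prod_eq_iff\<close>)
  \<comment> \<open>Pigeonhole on the promise component of the letters fixes one
    \<open>q\<close>.\<close>
  then obtain q where "\<exists>\<^sub>\<infinity>j. collection_run i \<rho> (j + Suc i) = Some p \<and> w (j + Suc i) = (\<sigma>, q)
      \<and> collection_run i \<rho> (Suc (j + Suc i)) = Some p'"
    by (rule frequently_bex_finite[OF assms(1), THEN bexE])
  then have "\<exists>\<^sub>\<infinity>j. collection_run i \<rho> j = Some p \<and> w j = (\<sigma>, q)
      \<and> collection_run i \<rho> (Suc j) = Some p'"
    by (subst (asm) INFM_shift_iff)
  moreover have "Some p' \<in> coll_rej A (Some p) (\<sigma>, q)"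
    using rej by simp
  ultimately show "rejecting (collection A) w (collection_run i \<rho>)"
    unfolding rejecting_def collection_simps by blast
qed

text \<open>The self-loop on \<open>None\<close> is not rejecting, since \<open>coll_rej\<close>
  yields only \<open>Some\<close> states.\<close>

lemma not_rejecting_constant_None:
  assumes "\<And>j. \<rho> j = None"
  shows "\<not> rejecting (collection A) w \<rho>"
  using assms by (auto simp: rejecting_def INFM_nat)

theorem theorem3:
  fixes A :: "('a, 'q) uca_schema" and w :: "('a \<times> 'q) word"
  assumes "wf_schema A"
    and "range w \<subseteq> alphabet A \<times> states A"
  shows "accepts (collection A) w \<longleftrightarrow> (\<forall>i. fst \<circ> suffix i w \<in> lang A (snd (w i)))"
proof -
  have letters: "fst (w j) \<in> alphabet A" "snd (w j) \<in> states A" for j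
    using assms(2) by (metis mem_Times_iff rangeI subsetD)+
  have rej_iff: "rejecting (collection A) w (collection_run i \<rho>)
      \<longleftrightarrow> rejecting A (fst \<circ> suffix i w) \<rho>" for i \<rho>
    using assms(1) letters by (intro rejecting_collection_run_iff) (auto simp: wf_schema_def)
  have "(\<exists>\<rho>'. is_run (collection A) None w \<rho>' \<and> rejecting (collection A) w \<rho>') \<longleftrightarrow>
      (\<exists>i \<rho>. is_run A (snd (w i)) (fst \<circ> suffix i w) \<rho> \<and> rejecting A (fst \<circ> suffix i w) \<rho>)"
    by (metis collection_run_cases is_run_collection_run not_rejecting_constant_None rej_iff)
  \<comment> \<open>Membership in \<open>lang\<close> also requires the letters to come from the
    alphabet.\<close>
  moreover have "range (fst \<circ> suffix i w) \<subseteq> alphabet A" for i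
    using letters by auto
  ultimately show ?thesis
    using assms(2) by (auto simp: accepts_def lang_def)
qed

end
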